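(* Let $\operatorname{opt}_1$ and $\operatorname{opt}_2$ be choice functions such that $\operatorname{opt}_1$ satisfies the backward conditioning property, insensitivity of optimality to the omission of non-optimal elements, preservation of non-optimality under the addition of elements, and the backward mixture property, and such that for any non-empty event $A$ and any non-empty finite set $\mathcal{X}$ of $A$-consistent gambles, $$\operatorname{opt}_1(\mathcal{X}|A)\subseteq\operatorname{opt}_2(\mathcal{X}|A).$$ Then, for any consistent decision tree $T$, $$\operatorname{norm}_{\operatorname{opt}_1}(T)=\operatorname{norm}_{\operatorname{opt}_1}(\operatorname{back}_{\operatorname{opt}_2}(T)).$$
   Context: **Basics.** $\Omega$ is a finite non-empty set (possibility space); events are subsets of $\Omega$, and $\overline{A}$ is the complement of $A$. A gamble is a function $X\colon\Omega\to\mathbb{R}$. An event also denotes its indicator, so $AX$ means $I_AX$. For sets of gambles, $A\mathcal{X}=\{AX\colon X\in\mathcal{X}\}$, $A\mathcal{X}+\overline{A}\mathcal{Z}=\{AX+\overline{A}Z\colon X\in\mathcal{X},Z\in\mathcal{Z}\}$ and $A\mathcal{X}+\overline{A}Z=A\mathcal{X}+\overline{A}\{Z\}$. For a non-empty event $A$, a set $\mathcal{X}$ of gambles is $A$-consistent if for all $r\in\mathbb{R}$ and $X\in\mathcal{X}$ with $X^{-1}(r)\neq\emptyset$ we have $X^{-1}(r)\cap A\neq\emptyset$; a gamble $X$ is $A$-consistent if $\{X\}$ is. **Choice functions.** A choice function $\operatorname{opt}$ maps, for each non-empty event $A$, each non-empty finite set $\mathcal{X}$ of gambles to a non-empty subset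 $\operatorname{opt}(\mathcal{X}|A)\subseteq\mathcal{X}$. Properties of a choice function $\operatorname{opt}$: - *Backward conditioning property*: let $A,B$ be events with $A\cap B\neq\emptyset$ and $\overline{A}\cap B\neq\emptyset$, and let $\mathcal{X}$ be a non-empty finite $A\cap B$-consistent set of gambles with $\{X,Y\}\subseteq\mathcal{X}$ and $AX=AY$. Then $X\in\operatorname{opt}(\mathcal{X}|A\cap B)$ implies $Y\in\operatorname{opt}(\mathcal{X}|A\cap B)$ whenever there is a non-empty finite $\overline{A}\cap B$-consistent set of gambles $\mathcal{Z}$ such that, for at least one $Z\in\mathcal{Z}$, $AX+\overline{A}Z\in\operatorname{opt}(A\mathcal{X}+\overline{A}\mathcal{Z}|B)$. - *Insensitivity of optimality to the omission of non-optimal elements*: for any event $A\neq\emptyset$ and non-empty finite $A$-consistent sets of gambles $\mathcal{X},\mathcal{Y}$, $\operatorname{opt}(\mathcal{X}|A)\subseteq\mathcal{Y}\subseteq\mathcal{X}$ implies $\operatorname{opt}(\mathcal{Y}|A)=\operatorname{opt}(\mathcal{X}|A)$. - *Preservation of non-optimality under the addition of elements*: for any event $A\neq\emptyset$ and non-empty finite $A$-consistent sets of gambles $\mathcal{X},\mathcal{Y}$, $\mathcal{Y}\subseteq\mathcal{X}$ implies $\operatorname{opt}(\mathcal{Y}|A)\supseteq\operatorname{opt}(\mathcal{X}|A)\cap\mathcal{Y}$. - *Backward mixture property*: for any events $A,B$ with $B\cap A\neq\emptyset$ and $B\cap\overline{A}\neq\emptyset$, any $B\cap\overline{A}$-consistent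 gamble $Z$, and any non-empty finite $B\cap A$-consistent set of gambles $\mathcal{X}$, $\operatorname{opt}(A\mathcal{X}+\overline{A}Z|B)\subseteq A\operatorname{opt}(\mathcal{X}|A\cap B)+\overline{A}Z$. **Decision trees.** A decision tree is a finite rooted tree whose nodes are reward leaves (labelled by real numbers), decision nodes, and chance nodes; the arcs leaving a chance node are labelled by events forming a partition of $\Omega$. With every tree $T$ is associated an event $\operatorname{ev}(T)$, the intersection of all events on chance arcs that precede $T$. For a node $N$ of $T$, $\operatorname{st}_N(T)$ denotes the subtree of $T$ at $N$ (all non-descendants of $N$ removed); $\operatorname{ev}(\operatorname{st}_N(T))$ is the intersection of $\operatorname{ev}(T)$ with all events on the chance arcs on the path from the root of $T$ to $N$. $T$ is consistent if $\operatorname{ev}(\operatorname{st}_N(T))\neq\emptyset$ for every node $N$ of $T$. **Normal form decisions and gambles.** A normal form decision of $T$ is a reduced tree obtained from $T$ by keeping exactly one arc at each decision node (and discarding the parts no longer reachable); it has the same associated event $\operatorname{ev}(T)$. $\operatorname{nfd}(T)$ is the set of all of them. Each normal form decision $U$ has a gamble: a leaf with reward $r$ gives the constant gamble $r$; a decision node gives the gamble of its single remaining subtree; a chance node with events $E_1,\dots,E_n$ whose subtrees have gambles $X_1,\dots,X_n$ gives $\sum_{i=1}^n E_iX_i$. For $U\in\operatorname{nfd}(T)$, $\operatorname{gamb}(U)$ is the singleton containing its gamble; for a set $\mathcal{U}$ of normal form decisions $\operatorname{gamb}(\mathcal{U})=\bigcup_{U\in\mathcal{U}}\operatorname{gamb}(U)$;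 and $\operatorname{gamb}(T)=\operatorname{gamb}(\operatorname{nfd}(T))$. **The two solution operators.** For a choice function $\operatorname{opt}$ and a consistent tree $T$, $$\operatorname{norm}_{\operatorname{opt}}(T)=\{U\in\operatorname{nfd}(T)\colon\operatorname{gamb}(U)\subseteq\operatorname{opt}(\operatorname{gamb}(T)|\operatorname{ev}(T))\},$$ and for a non-empty set $\mathcal{U}\subseteq\operatorname{nfd}(T)$, $$\operatorname{norm}_{\operatorname{opt}}(\mathcal{U})=\{U\in\mathcal{U}\colon\operatorname{gamb}(U)\subseteq\operatorname{opt}(\operatorname{gamb}(\mathcal{U})|\operatorname{ev}(T))\}.$$ The normal form backward induction operator $\operatorname{back}_{\operatorname{opt}}$ is defined recursively from right to left: if $T$ is a reward leaf, $\operatorname{back}_{\operatorname{opt}}(T)=\{T\}$. Otherwise, let $S(T)$ be the set of those $U\in\operatorname{nfd}(T)$ such that, for each child subtree $T_i$ of the root of $T$ that is retained in $U$ (all children if the root is a chance node, the chosen child if it is a decision node), the restriction of $U$ to $T_i$ belongs to $\operatorname{back}_{\operatorname{opt}}(T_i)$, where $T_i$ carries its event $\operatorname{ev}(T_i)$ as a subtree of $T$; then $\operatorname{back}_{\operatorname{opt}}(T)=\operatorname{norm}_{\operatorname{opt}}(S(T))$. *)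

theory Defs
  imports Complex_Main "HOL-Library.Disjoint_Sets" "HOL-Library.Indicator_Function"
begin

text \<open>The possibility space is the universe of a type of class \<open>finite\<close>.\<close>

type_synonym 'w gamble = "'w \<Rightarrow> real"

type_synonym 'w choice = "'w gamble set \<Rightarrow> 'w set \<Rightarrow> 'w gamble set"
  \<comment> \<open>\<open>opt \<X> A\<close> is the set of options chosen from \<open>\<X>\<close> conditional on \<open>A\<close>\<close>

definition restr :: "'w set \<Rightarrow> 'w gamble \<Rightarrow> 'w gamble" where
  "restr A X = (\<lambda>\<omega>. indicator A \<omega> * X \<omega>)"

definition mix :: "'w set \<Rightarrow> 'w gamble \<Rightarrow> 'w gamble \<Rightarrow> 'w gamble" where
  "mix A X Z = (\<lambda>\<omega>. restr A X \<omega> + restr (- A) Z \<omega>)"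

definition mix_sets :: "'w set \<Rightarrow> 'w gamble set \<Rightarrow> 'w gamble set \<Rightarrow> 'w gamble set" where
  "mix_sets A \<X> \<Z> = {mix A X Z | X Z. X \<in> \<X> \<and> Z \<in> \<Z>}"

definition consistent_gambles :: "'w set \<Rightarrow> 'w gamble set \<Rightarrow> bool" where
  "consistent_gambles A \<X> \<longleftrightarrow>
     (\<forall>r. \<forall>X\<in>\<X>. X -` {r} \<noteq> {} \<longrightarrow> X -` {r} \<inter> A \<noteq> {})"

definition choice_function :: "'w choice \<Rightarrow> bool" where
  "choice_function opt \<longleftrightarrow>
     (\<forall>A \<X>. A \<noteq> {} \<longrightarrow> finite \<X> \<longrightarrow> \<X> \<noteq> {} \<longrightarrow> opt \<X> A \<noteq> {} \<and> opt \<X> A \<subseteq> \<X>)"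

definition backward_conditioning :: "'w choice \<Rightarrow> bool" where
  "backward_conditioning opt \<longleftrightarrow>
     (\<forall>A B \<X> X Y.
        A \<inter> B \<noteq> {} \<longrightarrow> - A \<inter> B \<noteq> {} \<longrightarrow>
        finite \<X> \<longrightarrow> \<X> \<noteq> {} \<longrightarrow> consistent_gambles (A \<inter> B) \<X> \<longrightarrow>
        {X, Y} \<subseteq> \<X> \<longrightarrow> restr A X = restr A Y \<longrightarrow>
        (\<exists>\<Z>. finite \<Z> \<and> \<Z> \<noteq> {} \<and> consistent_gambles (- A \<inter> B) \<Z> \<and>
             (\<exists>Z\<in>\<Z>. mix A X Z \<in> opt (mix_sets A \<X> \<Z>) B)) \<longrightarrow>
        X \<in> opt \<X> (A \<inter> B) \<longrightarrow> Y \<in> opt \<X> (A \<inter> B))"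

definition insensitivity_to_omission :: "'w choice \<Rightarrow> bool" where
  "insensitivity_to_omission opt \<longleftrightarrow>
     (\<forall>A \<X> \<Y>.
        A \<noteq> {} \<longrightarrow>
        finite \<X> \<longrightarrow> \<X> \<noteq> {} \<longrightarrow> consistent_gambles A \<X> \<longrightarrow>
        finite \<Y> \<longrightarrow> \<Y> \<noteq> {} \<longrightarrow> consistent_gambles A \<Y> \<longrightarrow>
        opt \<X> A \<subseteq> \<Y> \<longrightarrow> \<Y> \<subseteq> \<X> \<longrightarrow> opt \<Y> A = opt \<X> A)"

definition preservation_of_nonoptimality :: "'w choice \<Rightarrow> bool" where
  "preservation_of_nonoptimality opt \<longleftrightarrow>
     (\<forall>A \<X> \<Y>.
        A \<noteq> {} \<longrightarrow>
        finite \<X> \<longrightarrow> \<X> \<noteq> {} \<longrightarrow> consistent_gambles A \<X> \<longrightarrow>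
        finite \<Y> \<longrightarrow> \<Y> \<noteq> {} \<longrightarrow> consistent_gambles A \<Y> \<longrightarrow>
        \<Y> \<subseteq> \<X> \<longrightarrow> opt \<X> A \<inter> \<Y> \<subseteq> opt \<Y> A)"

definition backward_mixture :: "'w choice \<Rightarrow> bool" where
  "backward_mixture opt \<longleftrightarrow>
     (\<forall>A B Z \<X>.
        B \<inter> A \<noteq> {} \<longrightarrow> B \<inter> - A \<noteq> {} \<longrightarrow>
        consistent_gambles (B \<inter> - A) {Z} \<longrightarrow>
        finite \<X> \<longrightarrow> \<X> \<noteq> {} \<longrightarrow> consistent_gambles (B \<inter> A) \<X> \<longrightarrow>
        opt (mix_sets A \<X> {Z}) B \<subseteq> mix_sets A (opt \<X> (A \<inter> B)) {Z})"

text \<open>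
  Arcs leaving a decision node carry names (pairwise distinct in a well-formed tree), so that
  choosing different arcs gives different normal form decisions even if the subtrees at the ends
  of these arcs are equal.
\<close>

datatype ('w, 'd) dtree =
    Reward real
  | Decision "('d \<times> ('w, 'd) dtree) list"
  | Chance "('w set \<times> ('w, 'd) dtree) list"

lemma size_arc [termination_simp]:
  "(x, t) \<in> set ts \<Longrightarrow> size t < Suc (size_list (size_prod (\<lambda>_. 0) size) ts)"
  by (induction ts) auto

fun decision_tree :: "('w, 'd) dtree \<Rightarrow> bool" where
  "decision_tree (Reward r) \<longleftrightarrow> True"
| "decision_tree (Decision ds) \<longleftrightarrow>
     ds \<noteq> [] \<and> distinct (map fst ds) \<and> (\<forall>(d, t) \<in> set ds. decision_tree t)"
| "decision_tree (Chance cs) \<longleftrightarrow>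
     distinct (map fst cs) \<and> partition_on UNIV (set (map fst cs)) \<and>
     (\<forall>(E, t) \<in> set cs. decision_tree t)"

text \<open>
  The event of a tree depends on what precedes the tree, so it is not part of the datatype: the
  operations below take it as an extra argument \<open>A\<close>. The set \<open>subtrees A T\<close> collects the pairs of
  event and subtree at all nodes of a tree \<open>T\<close> with event \<open>A\<close>.
\<close>

fun subtrees :: "'w set \<Rightarrow> ('w, 'd) dtree \<Rightarrow> ('w set \<times> ('w, 'd) dtree) set" where
  "subtrees A (Reward r) = {(A, Reward r)}"
| "subtrees A (Decision ds) = insert (A, Decision ds) (\<Union>(d, t) \<in> set ds. subtrees A t)"
| "subtrees A (Chance cs) = insert (A, Chance cs) (\<Union>(E, t) \<in> set cs. subtrees (A \<inter> E) t)"

definition consistent_tree :: "'w set \<Rightarrow> ('w, 'd) dtree \<Rightarrow> bool" where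
  "consistent_tree A T \<longleftrightarrow> (\<forall>(B, S) \<in> subtrees A T. B \<noteq> {})"

fun nfd :: "('w, 'd) dtree \<Rightarrow> ('w, 'd) dtree set" where
  "nfd (Reward r) = {Reward r}"
| "nfd (Decision ds) = (\<Union>(d, t) \<in> set ds. {Decision [(d, U)] | U. U \<in> nfd t})"
| "nfd (Chance cs) = Chance ` listset (map (\<lambda>(E, t). {(E, U) | U. U \<in> nfd t}) cs)"

text \<open>Only meaningful for normal form decisions; the last equation is a dummy value.\<close>

fun gamble :: "('w, 'd) dtree \<Rightarrow> 'w gamble" where
  "gamble (Reward r) = (\<lambda>_. r)"
| "gamble (Decision [(d, U)]) = gamble U"
| "gamble (Chance cs) = (\<lambda>\<omega>. \<Sum>(E, U) \<leftarrow> cs. indicator E \<omega> * gamble U \<omega>)"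
| "gamble (Decision _) = (\<lambda>_. 0)"

definition gamb_nf :: "('w, 'd) dtree \<Rightarrow> 'w gamble set" where
  "gamb_nf U = {gamble U}"

definition gamb_set :: "('w, 'd) dtree set \<Rightarrow> 'w gamble set" where
  "gamb_set \<U> = (\<Union>U\<in>\<U>. gamb_nf U)"

definition gamb :: "('w, 'd) dtree \<Rightarrow> 'w gamble set" where
  "gamb T = gamb_set (nfd T)"

definition norm_opt :: "'w choice \<Rightarrow> 'w set \<Rightarrow> ('w, 'd) dtree \<Rightarrow> ('w, 'd) dtree set" where
  "norm_opt opt A T = {U \<in> nfd T. gamb_nf U \<subseteq> opt (gamb T) A}"

definition norm_opt_set ::
    "'w choice \<Rightarrow> 'w set \<Rightarrow> ('w, 'd) dtree set \<Rightarrow> ('w, 'd) dtree set" where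
  "norm_opt_set opt A \<U> = {U \<in> \<U>. gamb_nf U \<subseteq> opt (gamb_set \<U>) A}"

text \<open>
  The arguments of \<open>norm_opt_set\<close> are the normal form decisions of the tree whose restrictions to
  all retained children lie in the backward induction solutions of these children.
\<close>

fun back_opt :: "'w choice \<Rightarrow> 'w set \<Rightarrow> ('w, 'd) dtree \<Rightarrow> ('w, 'd) dtree set" where
  "back_opt opt A (Reward r) = {Reward r}"
| "back_opt opt A (Decision ds) = norm_opt_set opt A
     (nfd (Decision ds) \<inter> (\<Union>(d, t) \<in> set ds. {Decision [(d, U)] | U. U \<in> back_opt opt A t}))"
| "back_opt opt A (Chance cs) = norm_opt_set opt A
     (nfd (Chance cs) \<inter>
      Chance ` listset (map (\<lambda>(E, t). {(E, U) | U. U \<in> back_opt opt (A \<inter> E) t}) cs))"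

end

theory Submission imports Defs
begin

text \<open>
  By induction on the tree, every \<open>opt1\<close>-optimal normal form decision survives backward induction
  with \<open>opt2\<close>; insensitivity to omission then yields the theorem. Below a decision node this is
  preservation of non-optimality. Below a chance node with arc \<open>E\<close>, write the optimal gamble as
  \<open>mix E X Z\<close>, where \<open>X\<close> is the gamble of the restriction to the subtree of \<open>E\<close>. Preservation
  and backward mixture give an optimal gamble \<open>Y\<close> of that subtree with \<open>mix E Y Z = mix E X Z\<close>, and
  backward conditioning transfers the optimality from \<open>Y\<close> to \<open>X\<close>.
\<close>

section \<open>Normal form decisions of a chance node as choices along its arcs\<close>

definition choice_of_arcs ::
    "('a \<Rightarrow> 'b \<Rightarrow> 'c set) \<Rightarrow> ('a \<times> 'c) list \<Rightarrow> ('a \<times> 'b) list \<Rightarrow> bool" where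
  "choice_of_arcs F us cs \<longleftrightarrow> list_all2 (\<lambda>(E', U) (E, t). E' = E \<and> U \<in> F E t) us cs"

text \<open>Covers the \<open>listset\<close> expressions of both \<open>nfd\<close> and
  \<open>back_opt\<close>. The parameter \<open>F\<close> receives the arc event besides the subtree
  because the backward induction solution of a subtree depends on its event.\<close>

lemma in_listset_arcs_iff:
  "us \<in> listset (map (\<lambda>(E, t). {(E, U) | U. U \<in> F E t}) cs) \<longleftrightarrow> choice_of_arcs F us cs"
  by (induction cs arbitrary: us)
    (auto simp: choice_of_arcs_def set_Cons_def list_all2_Cons2 image_iff)

lemma in_nfd_Chance_iff:
  "Chance us \<in> nfd (Chance cs) \<longleftrightarrow> choice_of_arcs (\<lambda>_. nfd) us cs"
  by (auto simp: image_iff in_listset_arcs_iff[where F = "\<lambda>_. nfd"])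

lemma nfd_ChanceE:
  assumes "U \<in> nfd (Chance cs)"
  obtains us where "U = Chance us" "choice_of_arcs (\<lambda>_. nfd) us cs"
  using assms by (auto simp: in_listset_arcs_iff[where F = "\<lambda>_. nfd"])

lemma choice_of_arcs_map_fst: "choice_of_arcs F us cs \<Longrightarrow> map fst us = map fst cs"
  by (auto simp: choice_of_arcs_def list_all2_conv_all_nth split_beta intro!: nth_equalityI)

lemma choice_of_arcs_nth:
  "choice_of_arcs F us cs \<longleftrightarrow> length us = length cs \<and>
     (\<forall>i < length cs. fst (us ! i) = fst (cs ! i) \<and> snd (us ! i) \<in> F (fst (cs ! i)) (snd (cs ! i)))"
  by (auto simp: choice_of_arcs_def list_all2_conv_all_nth split_beta)

lemma choice_of_arcs_memE:
  assumes "choice_of_arcs F us cs" "(E, t) \<in> set cs"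
  obtains U where "(E, U) \<in> set us" "U \<in> F E t"
proof -
  obtain i where i: "i < length cs" "cs ! i = (E, t)"
    using assms(2) by (auto simp: in_set_conv_nth)
  then have "us ! i = (E, snd (us ! i))" "snd (us ! i) \<in> F E t" "i < length us"
    using assms(1) by (auto simp: choice_of_arcs_nth prod_eq_iff)
  then show thesis using that by (metis nth_mem)
qed

section \<open>Finiteness and existence of normal form decisions\<close>

lemma listset_nonempty: "(\<And>A. A \<in> set As \<Longrightarrow> A \<noteq> {}) \<Longrightarrow> listset As \<noteq> {}"
  by (induction As) (auto simp: set_Cons_def)

lemma finite_listset: "(\<And>A. A \<in> set As \<Longrightarrow> finite A) \<Longrightarrow> finite (listset As)"
proof (induction As)
  case (Cons A As)
  have "set_Cons A (listset As) = (\<lambda>(x, xs). x # xs) ` (A \<times> listset As)"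
    by (auto simp: set_Cons_def)
  with Cons show ?case by auto
qed simp

lemma finite_nfd: "finite (nfd T)"
proof (induction T rule: nfd.induct)
  case (2 ds)
  then show ?case by (auto simp: Setcompr_eq_image)
next
  case (3 cs)
  then show ?case by (auto simp: Setcompr_eq_image intro!: finite_imageI finite_listset)
qed simp

lemma nfd_nonempty: "decision_tree T \<Longrightarrow> nfd T \<noteq> {}"
proof (induction T rule: nfd.induct)
  case (2 ds)
  then obtain d t where "(d, t) \<in> set ds" by (cases ds) auto
  with 2 show ?case by fastforce
next
  case (3 cs)
  then have "listset (map (\<lambda>(E, t). {(E, U) | U. U \<in> nfd t}) cs) \<noteq> {}"
    by (intro listset_nonempty) fastforce
  then show ?case by simp
qed simp

lemma gamb_set_eq_image: "gamb_set \<U> = gamble ` \<U>"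
  by (auto simp: gamb_set_def gamb_nf_def)

lemma gamb_eq_image: "gamb T = gamble ` nfd T"
  by (simp add: gamb_def gamb_set_eq_image)

lemma finite_gamb: "finite (gamb T)"
  by (simp add: gamb_eq_image finite_nfd)

lemma gamb_nonempty: "decision_tree T \<Longrightarrow> gamb T \<noteq> {}"
  by (simp add: gamb_eq_image nfd_nonempty)

section \<open>Events of subtrees and values of gambles at chance nodes\<close>

lemma consistent_tree_event: "consistent_tree A T \<Longrightarrow> A \<noteq> {}"
  by (cases T) (auto simp: consistent_tree_def)

lemma consistent_tree_Decision:
  "consistent_tree A (Decision ds) \<Longrightarrow> (d, t) \<in> set ds \<Longrightarrow> consistent_tree A t"
  by (fastforce simp: consistent_tree_def)

lemma consistent_tree_Chance:
  "consistent_tree A (Chance cs) \<Longrightarrow> (E, t) \<in> set cs \<Longrightarrow> consistent_tree (A \<inter> E) t"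
  by (fastforce simp: consistent_tree_def)

text \<open>At a point of \<open>E\<close> the summands of all other arcs vanish: distinct labels
  mean that another arc has another event, and disjointness keeps the point out of it.\<close>

lemma gamble_Chance_on_arc:
  assumes "distinct (map fst us)" "disjoint (set (map fst us))" "(E, U) \<in> set us" "\<omega> \<in> E"
  shows "gamble (Chance us) \<omega> = gamble U \<omega>"
proof -
  have zero: "indicator E' \<omega> * gamble U' \<omega> = (0::real)"
    if "(E', U') \<in> set us" "(E', U') \<noteq> (E, U)" for E' U'
  proof -
    have "E' \<noteq> E" using that assms(1,3) by (metis eq_key_imp_eq_value)
    then have "E' \<inter> E = {}"
      using assms(2,3) that(1) by (force simp: disjoint_def)
    with assms(4) show ?thesis by (auto simp: indicator_def)
  qed
  have "gamble (Chance us) \<omega> = (\<Sum>(E, U)\<in>set us. indicator E \<omega> * gamble U \<omega>)"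
    using assms(1) by (simp add: sum_list_distinct_conv_sum_set distinct_map)
  also have "\<dots> = (\<Sum>(E, U)\<in>{(E, U)}. indicator E \<omega> * gamble U \<omega>)"
    using assms(3) by (intro sum.mono_neutral_right) (auto intro: zero simp del: Pair_inject mult_eq_0_iff)
  finally show ?thesis using assms(4) by simp
qed

lemma gamble_choice_of_arcs:
  assumes "decision_tree (Chance cs)" "choice_of_arcs F us cs" "(E, U) \<in> set us" "\<omega> \<in> E"
  shows "gamble (Chance us) \<omega> = gamble U \<omega>"
  using assms choice_of_arcs_map_fst[OF assms(2)]
  by (intro gamble_Chance_on_arc) (auto simp: partition_on_def)

lemma decision_tree_arc_cover:
  assumes "decision_tree (Chance cs)"
  obtains E t where "(E, t) \<in> set cs" "\<omega> \<in> E"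
  using assms by (force simp: partition_on_def)

section \<open>Consistency of the gambles of a tree\<close>

lemma consistent_gambles_iff: "consistent_gambles A \<X> \<longleftrightarrow> (\<forall>X\<in>\<X>. \<forall>\<omega>. \<exists>\<omega>'\<in>A. X \<omega>' = X \<omega>)"
  by (fastforce simp: consistent_gambles_def)

lemma consistent_gambles_subset:
  "consistent_gambles A \<X> \<Longrightarrow> \<Y> \<subseteq> \<X> \<Longrightarrow> consistent_gambles A \<Y>"
  by (auto simp: consistent_gambles_def)

text \<open>Supplies the consistency hypotheses in the properties of \<open>opt1\<close>. At a
  chance node, the value at a point of an arc event \<open>E\<close> is a value of the gamble chosen
  on that arc. By induction it is attained on \<open>A \<inter> E\<close>, where the two gambles
  agree.\<close>

lemma consistent_gambles_gamb:
  "decision_tree T \<Longrightarrow> consistent_tree A T \<Longrightarrow> consistent_gambles A (gamb T)"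
proof (induction T arbitrary: A rule: nfd.induct)
  case (1 r)
  then show ?case
    using consistent_tree_event by (fastforce simp: consistent_gambles_iff gamb_eq_image)
next
  case (2 ds)
  have "consistent_gambles A (gamb t)" if "(d, t) \<in> set ds" for d t
    using 2 that consistent_tree_Decision by fastforce
  then show ?case by (fastforce simp: consistent_gambles_iff gamb_eq_image)
next
  case (3 cs)
  have IH: "consistent_gambles (A \<inter> E) (gamb t)" if "(E, t) \<in> set cs" for E t
    using 3 that consistent_tree_Chance by fastforce
  show ?case unfolding consistent_gambles_iff gamb_eq_image
  proof (intro ballI allI)
    fix X \<omega> assume "X \<in> gamble ` nfd (Chance cs)"
    then obtain us where us: "choice_of_arcs (\<lambda>_. nfd) us cs" and X: "X = gamble (Chance us)"
      by (auto elim!: nfd_ChanceE simp del: nfd.simps gamble.simps)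
    obtain E t where E: "(E, t) \<in> set cs" "\<omega> \<in> E"
      using decision_tree_arc_cover[OF 3(2)] .
    then obtain U where U: "(E, U) \<in> set us" "U \<in> nfd t"
      using us by (metis choice_of_arcs_memE)
    obtain \<omega>' where "\<omega>' \<in> A \<inter> E" "gamble U \<omega>' = gamble U \<omega>"
      using IH[OF E(1)] U(2) by (fastforce simp: consistent_gambles_iff gamb_eq_image)
    then show "\<exists>\<omega>'\<in>A. X \<omega>' = X \<omega>"
      using gamble_choice_of_arcs[OF 3(2) us U(1)] E(2) X
      by (intro bexI[of _ \<omega>']) (auto simp del: gamble.simps)
  qed
qed

section \<open>Mixtures and optimality along a chance arc\<close>

lemma mix_apply: "mix A X Z \<omega> = (if \<omega> \<in> A then X \<omega> else Z \<omega>)"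
  by (simp add: mix_def restr_def)

lemma mix_eqD: "mix A X Z = mix A Y Z' \<Longrightarrow> restr A X = restr A Y"
  by (auto simp: fun_eq_iff mix_apply restr_def indicator_def split: if_splits)

lemma optimal_component:
  assumes choice: "choice_function opt"
    and cond: "backward_conditioning opt"
    and pres: "preservation_of_nonoptimality opt"
    and mixture: "backward_mixture opt"
    and E: "E \<inter> A \<noteq> {}" "- E \<inter> A \<noteq> {}"
    and \<X>: "finite \<X>" "consistent_gambles (E \<inter> A) \<X>"
    and \<Z>: "finite \<Z>" "consistent_gambles (- E \<inter> A) \<Z>"
    and cons: "consistent_gambles A (mix_sets E \<X> \<Z>)"
    and X: "X \<in> \<X>" and Z: "Z \<in> \<Z>"
    and opt: "mix E X Z \<in> opt (mix_sets E \<X> \<Z>) A"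
  shows "X \<in> opt \<X> (E \<inter> A)"
proof -
  have fin: "finite (mix_sets E \<X> \<Z>)"
    using finite_image_set2[of "\<lambda>X. X \<in> \<X>" "\<lambda>Z. Z \<in> \<Z>"] \<X>(1) \<Z>(1) by (simp add: mix_sets_def)
  have sub: "mix_sets E \<X> {Z} \<subseteq> mix_sets E \<X> \<Z>" and mem: "mix E X Z \<in> mix_sets E \<X> {Z}"
    using X Z by (auto simp: mix_sets_def)
  \<comment> \<open>Backward mixture allows only one gamble on the complement, so
    \<open>\<Z>\<close> is first cut down to \<open>{Z}\<close>; preservation keeps the mixture
    optimal.\<close>
  have "opt (mix_sets E \<X> \<Z>) A \<inter> mix_sets E \<X> {Z} \<subseteq> opt (mix_sets E \<X> {Z}) A"
    using pres[unfolded preservation_of_nonoptimality_def, rule_format,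
        of A "mix_sets E \<X> \<Z>" "mix_sets E \<X> {Z}"]
      fin finite_subset[OF sub fin] sub mem cons consistent_gambles_subset[OF cons sub] E by blast
  moreover have "opt (mix_sets E \<X> {Z}) A \<subseteq> mix_sets E (opt \<X> (E \<inter> A)) {Z}"
    using mixture[unfolded backward_mixture_def, rule_format, of A E Z \<X>]
      E \<X> X consistent_gambles_subset[OF \<Z>(2), of "{Z}"] Z by (auto simp: Int_commute)
  ultimately have "mix E X Z \<in> mix_sets E (opt \<X> (E \<inter> A)) {Z}"
    using opt mem by blast
  \<comment> \<open>Only the values on \<open>E\<close> can be recovered from the mixture, so
    \<open>Y\<close> may differ from \<open>X\<close> outside \<open>E\<close>. Backward
    conditioning closes this gap, with the whole of \<open>\<Z>\<close> as the set of gambles that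
    it asks for.\<close>
  then obtain Y where Y: "Y \<in> opt \<X> (E \<inter> A)" "mix E X Z = mix E Y Z"
    by (auto simp: mix_sets_def)
  then have r: "restr E Y = restr E X" by (metis mix_eqD)
  have "Y \<in> \<X>"
    using choice[unfolded choice_function_def, rule_format, of "E \<inter> A" \<X>] Y(1) E(1) \<X>(1) X
    by auto
  moreover have "mix E Y Z \<in> opt (mix_sets E \<X> \<Z>) A" using opt Y(2) by simp
  ultimately show ?thesis
    using cond[unfolded backward_conditioning_def, rule_format, of E A \<X> Y X]
      E \<X> \<Z> X Z Y(1) r by blast
qed

text \<open>Choices on different arcs are independent, so the gambles of the node are all mixtures
  of a gamble of the subtree at \<open>E\<close> with a gamble for the remaining arcs. This reduces
  the claim to \<open>optimal_component\<close>, unless \<open>E\<close> is all of the possibility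
  space.\<close>

lemma optimal_Chance_arc:
  assumes choice: "choice_function opt"
    and cond: "backward_conditioning opt"
    and pres: "preservation_of_nonoptimality opt"
    and mixture: "backward_mixture opt"
    and dt: "decision_tree (Chance cs)" and ct: "consistent_tree A (Chance cs)"
    and us: "choice_of_arcs (\<lambda>_. nfd) us cs"
    and opt: "gamble (Chance us) \<in> opt (gamb (Chance cs)) A"
    and i: "i < length cs"
  shows "gamble (snd (us ! i)) \<in> opt (gamb (snd (cs ! i))) (A \<inter> fst (cs ! i))"
proof -
  define E t U where "E = fst (cs ! i)" and "t = snd (cs ! i)" and "U = snd (us ! i)"
  have Et: "(E, t) \<in> set cs" using i by (simp add: E_def t_def)
  have len: "length us = length cs" and EU: "us ! i = (E, U)" and U: "U \<in> nfd t"
    using us i by (auto simp: choice_of_arcs_nth E_def t_def U_def prod_eq_iff)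
  have EUmem: "(E, U) \<in> set us" using EU len i by (metis nth_mem)
  have dt_t: "decision_tree t" using dt Et by auto
  have ct_t: "consistent_tree (A \<inter> E) t" using consistent_tree_Chance[OF ct Et] .
  \<comment> \<open>Independence of the arcs: the choice on arc \<open>i\<close> is exchanged and
    all others are kept.\<close>
  have replace: "\<exists>vs. choice_of_arcs (\<lambda>_. nfd) vs cs \<and>
      gamble (Chance vs) = mix E (gamble V) (gamble (Chance ws))"
    if ws: "choice_of_arcs (\<lambda>_. nfd) ws cs" and V: "V \<in> nfd t" for V ws
  proof (intro exI conjI)
    let ?vs = "ws[i := (E, V)]"
    have lenw: "length ws = length cs" using ws by (simp add: choice_of_arcs_nth)
    show vs: "choice_of_arcs (\<lambda>_. nfd) ?vs cs"
      using ws V i by (auto simp: choice_of_arcs_nth nth_list_update E_def t_def)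
    show "gamble (Chance ?vs) = mix E (gamble V) (gamble (Chance ws))"
    proof
      fix \<omega>
      show "gamble (Chance ?vs) \<omega> = mix E (gamble V) (gamble (Chance ws)) \<omega>"
      proof (cases "\<omega> \<in> E")
        case True
        have "(E, V) \<in> set ?vs" using i lenw by (simp add: set_update_memI)
        from gamble_choice_of_arcs[OF dt vs this True] show ?thesis
          using True by (simp add: mix_apply)
      next
        case False
        \<comment> \<open>Outside \<open>E\<close> the point lies in the event of some arc other
          than \<open>i\<close>, whose entry the update leaves alone.\<close>
        obtain E' t' where E': "(E', t') \<in> set cs" "\<omega> \<in> E'"
          using decision_tree_arc_cover[OF dt] .
        then obtain j where j: "j < length cs" "cs ! j = (E', t')"
          by (auto simp: in_set_conv_nth)
        have "j \<noteq> i" using False E'(2) j by (auto simp: E_def)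
        define W where "W = snd (ws ! j)"
        have wj: "ws ! j = (E', W)" "?vs ! j = (E', W)"
          using ws j \<open>j \<noteq> i\<close> by (auto simp: choice_of_arcs_nth W_def prod_eq_iff)
        then have "(E', W) \<in> set ws" "(E', W) \<in> set ?vs"
          using j lenw by (metis nth_mem, metis nth_mem length_list_update)
        then show ?thesis
          using gamble_choice_of_arcs[OF dt ws _ E'(2)] gamble_choice_of_arcs[OF dt vs _ E'(2)] False
          by (simp add: mix_apply del: gamble.simps)
      qed
    qed
  qed
  have on_E: "gamble (Chance us) \<omega> = gamble U \<omega>" if "\<omega> \<in> E" for \<omega>
    using gamble_choice_of_arcs[OF dt us EUmem that] .
  have AE: "E \<inter> A \<noteq> {}" using consistent_tree_event[OF ct_t] by auto
  have cons: "consistent_gambles A (gamb (Chance cs))"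
    using consistent_gambles_gamb[OF dt ct] .
  have cons_t: "consistent_gambles (E \<inter> A) (gamb t)"
    using consistent_gambles_gamb[OF dt_t ct_t] by (simp add: Int_commute)
  have "gamble U \<in> opt (gamb t) (E \<inter> A)"
  \<comment> \<open>If \<open>E = UNIV\<close>, the complementary event is empty and the backward
    properties say nothing; but then node and subtree have the same gambles and the same
    event.\<close>
  proof (cases "E = UNIV")
    case True
    have "gamb (Chance cs) = gamb t"
    proof (intro equalityI subsetI)
      fix X assume "X \<in> gamb (Chance cs)"
      then obtain ws where ws: "choice_of_arcs (\<lambda>_. nfd) ws cs" and X: "X = gamble (Chance ws)"
        by (auto simp: gamb_eq_image elim!: nfd_ChanceE simp del: nfd.simps gamble.simps)
      obtain W where W: "(E, W) \<in> set ws" "W \<in> nfd t"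
        using choice_of_arcs_memE[OF ws Et] .
      have "X = gamble W"
        using gamble_choice_of_arcs[OF dt ws W(1)] True X by (auto simp del: gamble.simps)
      then show "X \<in> gamb t" using W(2) by (simp add: gamb_eq_image)
    next
      fix X assume "X \<in> gamb t"
      then obtain V where V: "V \<in> nfd t" "X = gamble V" by (auto simp: gamb_eq_image)
      obtain vs where vs: "choice_of_arcs (\<lambda>_. nfd) vs cs"
        "gamble (Chance vs) = mix E (gamble V) (gamble (Chance us))"
        using replace[OF us V(1)] by blast
      have "gamble (Chance vs) = X" unfolding vs(2) using True V(2) by (auto simp: mix_apply)
      then show "X \<in> gamb (Chance cs)"
        using vs(1) unfolding gamb_eq_image by (metis imageI in_nfd_Chance_iff)
    qed
    moreover have "gamble (Chance us) = gamble U" using on_E True by blast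
    ultimately show ?thesis using opt True by (simp del: gamble.simps)
  next
    case False
    obtain E' t' where E': "(E', t') \<in> set cs" "E' \<noteq> E"
      using decision_tree_arc_cover[OF dt] False by (metis UNIV_eq_I)
    have disj: "F \<inter> E = {}" if "(F, s) \<in> set cs" "F \<noteq> E" for F s
      using dt Et that by (force simp: partition_on_def disjoint_def)
    \<comment> \<open>Consistency of the tree at a second arc provides a point of \<open>A\<close>
      outside \<open>E\<close>.\<close>
    obtain \<omega>0 where \<omega>0: "\<omega>0 \<in> - E \<inter> A"
      using consistent_tree_event[OF consistent_tree_Chance[OF ct E'(1)]] disj[OF E'] by auto
    \<comment> \<open>Any value on \<open>E\<close> is harmless for \<open>mix\<close>, but consistency needs one attained on \<open>- E \<inter> A\<close>.\<close>
    define ext where "ext X = mix E (\<lambda>_. X \<omega>0) X" for X :: "'a gamble"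
    define \<Z> where "\<Z> = ext ` gamb (Chance cs)"
    have mix_ext: "mix E X (ext Y) = mix E X Y" for X Y
      by (auto simp: ext_def mix_apply)
    \<comment> \<open>One inclusion is \<open>replace\<close>; for the other, a gamble of the node
      is mixed from its own choice on \<open>E\<close> and its own modification by
      \<open>ext\<close>.\<close>
    have eq: "mix_sets E (gamb t) \<Z> = gamb (Chance cs)"
    proof (intro equalityI subsetI)
      fix X assume "X \<in> mix_sets E (gamb t) \<Z>"
      then obtain V ws where V: "V \<in> nfd t" and ws: "choice_of_arcs (\<lambda>_. nfd) ws cs"
        and X: "X = mix E (gamble V) (gamble (Chance ws))"
        by (auto simp: mix_sets_def \<Z>_def gamb_eq_image mix_ext elim!: nfd_ChanceE
            simp del: nfd.simps gamble.simps)
      then show "X \<in> gamb (Chance cs)"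
        using replace[OF ws V] unfolding gamb_eq_image by (metis imageI in_nfd_Chance_iff)
    next
      fix X assume X: "X \<in> gamb (Chance cs)"
      then obtain ws where ws: "choice_of_arcs (\<lambda>_. nfd) ws cs" and Xw: "X = gamble (Chance ws)"
        by (auto simp: gamb_eq_image elim!: nfd_ChanceE simp del: nfd.simps gamble.simps)
      obtain W where W: "(E, W) \<in> set ws" "W \<in> nfd t"
        using choice_of_arcs_memE[OF ws Et] .
      have "X = mix E (gamble W) (ext X)"
        unfolding mix_ext using gamble_choice_of_arcs[OF dt ws W(1)] Xw
        by (auto simp: mix_apply simp del: gamble.simps)
      then show "X \<in> mix_sets E (gamb t) \<Z>"
        using W(2) X unfolding mix_sets_def \<Z>_def gamb_eq_image by blast
    qed
    \<comment> \<open>On \<open>E\<close> the value is the one at \<open>\<omega>0\<close>.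
      Elsewhere it comes from an arc \<open>F\<close> disjoint from \<open>E\<close>, and
      consistency of the subtree of \<open>F\<close> attains it on
      \<open>A \<inter> F\<close>.\<close>
    have cons_Z: "consistent_gambles (- E \<inter> A) \<Z>"
      unfolding consistent_gambles_iff
    proof (intro ballI allI)
      fix Z \<omega> assume "Z \<in> \<Z>"
      then obtain ws where ws: "choice_of_arcs (\<lambda>_. nfd) ws cs" and Z: "Z = ext (gamble (Chance ws))"
        by (auto simp: \<Z>_def gamb_eq_image elim!: nfd_ChanceE simp del: nfd.simps gamble.simps)
      show "\<exists>\<omega>'\<in>- E \<inter> A. Z \<omega>' = Z \<omega>"
      proof (cases "\<omega> \<in> E")
        case True
        then show ?thesis using \<omega>0 by (intro bexI[of _ \<omega>0]) (auto simp: Z ext_def mix_apply)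
      next
        case False
        obtain F s where F: "(F, s) \<in> set cs" "\<omega> \<in> F"
          using decision_tree_arc_cover[OF dt] .
        obtain W where W: "(F, W) \<in> set ws" "W \<in> nfd s"
          using choice_of_arcs_memE[OF ws F(1)] .
        have "consistent_gambles (A \<inter> F) (gamb s)"
          using consistent_gambles_gamb[OF _ consistent_tree_Chance[OF ct F(1)]] dt F(1) by auto
        then obtain \<omega>' where \<omega>': "\<omega>' \<in> A \<inter> F" "gamble W \<omega>' = gamble W \<omega>"
          using W(2) by (fastforce simp: consistent_gambles_iff gamb_eq_image)
        have "\<omega>' \<notin> E" using disj[OF F(1)] F(2) False \<omega>'(1) by auto
        then show ?thesis
          using False \<omega>' F(2) gamble_choice_of_arcs[OF dt ws W(1)]
          by (intro bexI[of _ \<omega>']) (auto simp: Z ext_def mix_apply simp del: gamble.simps)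
      qed
    qed
    have us_mix: "mix E (gamble U) (ext (gamble (Chance us))) = gamble (Chance us)"
      unfolding mix_ext using on_E by (auto simp: mix_apply simp del: gamble.simps)
    show ?thesis
    proof (rule optimal_component[OF choice cond pres mixture AE _ _ cons_t _ cons_Z])
      show "- E \<inter> A \<noteq> {}" using \<omega>0 by blast
      show "finite (gamb t)" by (rule finite_gamb)
      show "finite \<Z>" by (simp add: \<Z>_def finite_gamb)
      show "consistent_gambles A (mix_sets E (gamb t) \<Z>)" using cons eq by simp
      show "gamble U \<in> gamb t" using U by (simp add: gamb_eq_image)
      show "ext (gamble (Chance us)) \<in> \<Z>"
        unfolding \<Z>_def gamb_eq_image using us in_nfd_Chance_iff by blast
      show "mix E (gamble U) (ext (gamble (Chance us))) \<in> opt (mix_sets E (gamb t) \<Z>) A"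
        using opt eq us_mix by (simp del: gamble.simps)
    qed
  qed
  then show ?thesis by (simp add: E_def t_def U_def Int_commute)
qed

section \<open>Survival of optimal decisions under backward induction\<close>

lemma back_opt_subset_nfd: "back_opt opt A T \<subseteq> nfd T"
  by (cases T) (auto simp: norm_opt_set_def)

lemma norm_opt_iff: "U \<in> norm_opt opt A T \<longleftrightarrow> U \<in> nfd T \<and> gamble U \<in> opt (gamb T) A"
  by (simp add: norm_opt_def gamb_nf_def)

text \<open>The final selection at a node, with \<open>\<U>\<close> in the role of the candidates
  assembled from the children. Passing to fewer options keeps \<open>U\<close> optimal for
  \<open>opt1\<close> by preservation, and \<open>opt1\<close> selects no more than
  \<open>opt2\<close>.\<close>

lemma optimal_in_norm_opt_set:
  assumes pres: "preservation_of_nonoptimality opt1"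
    and le: "\<And>B \<X>. B \<noteq> {} \<Longrightarrow> finite \<X> \<Longrightarrow> \<X> \<noteq> {} \<Longrightarrow> consistent_gambles B \<X> \<Longrightarrow>
           opt1 \<X> B \<subseteq> opt2 \<X> B"
    and T: "decision_tree T" "consistent_tree A T"
    and U: "U \<in> norm_opt opt1 A T" "U \<in> \<U>" and sub: "\<U> \<subseteq> nfd T"
  shows "U \<in> norm_opt_set opt2 A \<U>"
proof -
  have A: "A \<noteq> {}" using consistent_tree_event[OF T(2)] .
  have s: "gamb_set \<U> \<subseteq> gamb T" using sub by (auto simp: gamb_set_eq_image gamb_eq_image)
  have fin: "finite (gamb_set \<U>)" using finite_subset[OF s finite_gamb] .
  have mem: "gamble U \<in> gamb_set \<U>" using U(2) by (simp add: gamb_set_eq_image)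
  have c: "consistent_gambles A (gamb_set \<U>)"
    using consistent_gambles_subset[OF consistent_gambles_gamb[OF T] s] .
  have "gamble U \<in> opt1 (gamb_set \<U>) A"
    using pres[unfolded preservation_of_nonoptimality_def, rule_format,
        of A "gamb T" "gamb_set \<U>"]
      A finite_gamb gamb_nonempty[OF T(1)] consistent_gambles_gamb[OF T] fin mem c s U(1)
    unfolding norm_opt_iff by blast
  with le[OF A fin _ c] mem U(2) show ?thesis by (auto simp: norm_opt_set_def gamb_nf_def)
qed

lemma norm_opt_subset_back_opt:
  fixes T :: "('w, 'd) dtree"
  assumes opt1: "choice_function opt1" "backward_conditioning opt1"
      "preservation_of_nonoptimality opt1" "backward_mixture opt1"
    and le: "\<And>B \<X>. B \<noteq> {} \<Longrightarrow> finite \<X> \<Longrightarrow> \<X> \<noteq> {} \<Longrightarrow> consistent_gambles B \<X> \<Longrightarrow>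
           opt1 \<X> B \<subseteq> opt2 \<X> B"
  shows "decision_tree T \<Longrightarrow> consistent_tree A T \<Longrightarrow> norm_opt opt1 A T \<subseteq> back_opt opt2 A T"
proof (induction T arbitrary: A rule: nfd.induct)
  case (1 r)
  then show ?case by (auto simp: norm_opt_def)
next
  case (2 ds)
  show ?case
  proof
    fix U assume opt: "U \<in> norm_opt opt1 A (Decision ds)"
    then obtain d t V where t: "(d, t) \<in> set ds" and V: "V \<in> nfd t" and UV: "U = Decision [(d, V)]"
      by (auto simp: norm_opt_iff)
    have dt: "decision_tree t" using 2(2) t by auto
    have ct: "consistent_tree A t" using consistent_tree_Decision[OF 2(3) t] .
    \<comment> \<open>A decision node passes its event on unchanged, so the child only has fewer
      options under the same event, which is the situation of preservation.\<close>
    have "gamb t \<subseteq> gamb (Decision ds)"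
    proof
      fix X assume "X \<in> gamb t"
      then obtain W where "W \<in> nfd t" "X = gamble (Decision [(d, W)])"
        by (auto simp: gamb_eq_image)
      then show "X \<in> gamb (Decision ds)"
        using t unfolding gamb_eq_image by (intro image_eqI) fastforce+
    qed
    then have "opt1 (gamb (Decision ds)) A \<inter> gamb t \<subseteq> opt1 (gamb t) A"
      using opt1(3)[unfolded preservation_of_nonoptimality_def, rule_format,
          of A "gamb (Decision ds)" "gamb t"]
        consistent_tree_event[OF ct] finite_gamb gamb_nonempty[OF dt] gamb_nonempty[OF 2(2)]
        consistent_gambles_gamb[OF dt ct] consistent_gambles_gamb[OF 2(2,3)] by blast
    moreover have "gamble V \<in> opt1 (gamb (Decision ds)) A"
      using opt UV by (simp add: norm_opt_iff)
    ultimately have "V \<in> norm_opt opt1 A t"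
      using V by (auto simp: norm_opt_iff gamb_eq_image)
    then have "V \<in> back_opt opt2 A t" using 2(1)[OF t refl dt ct] by blast
    then have "U \<in> nfd (Decision ds) \<inter>
        (\<Union>(d, t) \<in> set ds. {Decision [(d, U)] | U. U \<in> back_opt opt2 A t})"
      using t V UV by fastforce
    then show "U \<in> back_opt opt2 A (Decision ds)"
      unfolding back_opt.simps using opt
      by (intro optimal_in_norm_opt_set[OF opt1(3) le 2(2,3)]) auto
  qed
next
  case (3 cs)
  show ?case
  proof
    fix U assume opt: "U \<in> norm_opt opt1 A (Chance cs)"
    then obtain us where us: "choice_of_arcs (\<lambda>_. nfd) us cs" and U: "U = Chance us"
      by (auto simp: norm_opt_iff elim!: nfd_ChanceE simp del: nfd.simps gamble.simps)
    \<comment> \<open>By \<open>optimal_Chance_arc\<close> each restriction is optimal given the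
      event \<open>A \<inter> E\<close> of its own arc, so the induction hypothesis is applied with
      that event instead of \<open>A\<close>.\<close>
    have "choice_of_arcs (\<lambda>E t. back_opt opt2 (A \<inter> E) t) us cs"
      unfolding choice_of_arcs_nth
    proof (intro conjI allI impI)
      show "length us = length cs" using us by (simp add: choice_of_arcs_nth)
      fix i assume i: "i < length cs"
      then show "fst (us ! i) = fst (cs ! i)" using us by (simp add: choice_of_arcs_nth)
      obtain E t where Et: "cs ! i = (E, t)" by fastforce
      then have mem: "(E, t) \<in> set cs" using i by (metis nth_mem)
      have "gamble (snd (us ! i)) \<in> opt1 (gamb t) (A \<inter> E)"
        using optimal_Chance_arc[OF opt1 3(2,3) us _ i] opt U Et
        by (simp add: norm_opt_iff del: gamble.simps nfd.simps)
      moreover have "snd (us ! i) \<in> nfd t"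
        using us i Et by (auto simp: choice_of_arcs_nth)
      moreover have "norm_opt opt1 (A \<inter> E) t \<subseteq> back_opt opt2 (A \<inter> E) t"
        using 3(1)[OF mem refl _ consistent_tree_Chance[OF 3(3) mem]] 3(2) mem by auto
      ultimately show "snd (us ! i) \<in> back_opt opt2 (A \<inter> fst (cs ! i)) (snd (cs ! i))"
        using Et by (auto simp: norm_opt_iff)
    qed
    then have "us \<in> listset (map (\<lambda>(E, t). {(E, U) | U. U \<in> back_opt opt2 (A \<inter> E) t}) cs)"
      by (simp only: in_listset_arcs_iff)
    moreover have "U \<in> nfd (Chance cs)" using us U in_nfd_Chance_iff by blast
    ultimately have "U \<in> nfd (Chance cs) \<inter>
        Chance ` listset (map (\<lambda>(E, t). {(E, U) | U. U \<in> back_opt opt2 (A \<inter> E) t}) cs)"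
      using U by blast
    then show "U \<in> back_opt opt2 A (Chance cs)"
      unfolding back_opt.simps using opt
      by (intro optimal_in_norm_opt_set[OF opt1(3) le 3(2,3)]) auto
  qed
qed

theorem theoremA3:
  fixes opt1 opt2 :: "'w::finite choice"
    and T :: "('w, 'd) dtree"
    and A :: "'w set"
  assumes "choice_function opt1" and "choice_function opt2"
    and "backward_conditioning opt1"
    and "insensitivity_to_omission opt1"
    and "preservation_of_nonoptimality opt1"
    and "backward_mixture opt1"
    and "\<And>B \<X>. B \<noteq> {} \<Longrightarrow> finite \<X> \<Longrightarrow> \<X> \<noteq> {} \<Longrightarrow> consistent_gambles B \<X> \<Longrightarrow>
           opt1 \<X> B \<subseteq> opt2 \<X> B"
    and "decision_tree T" and "consistent_tree A T"
  shows "norm_opt opt1 A T = norm_opt_set opt1 A (back_opt opt2 A T)"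
proof -
  have A: "A \<noteq> {}" using consistent_tree_event[OF assms(9)] .
  have sub: "norm_opt opt1 A T \<subseteq> back_opt opt2 A T"
    by (rule norm_opt_subset_back_opt) (use assms in auto)
  let ?G = "gamb_set (back_opt opt2 A T)"
  have G: "?G \<subseteq> gamb T"
    using back_opt_subset_nfd[of opt2 A T] by (auto simp: gamb_set_eq_image gamb_eq_image)
  have cons: "consistent_gambles A (gamb T)" using consistent_gambles_gamb[OF assms(8,9)] .
  \<comment> \<open>Besides locating the optimal gambles, this makes \<open>?G\<close> non-empty
    once \<open>opt_G\<close> is known, as insensitivity requires.\<close>
  have opt: "opt1 (gamb T) A \<noteq> {}" "opt1 (gamb T) A \<subseteq> gamb T"
    using assms(1) A finite_gamb gamb_nonempty[OF assms(8)] unfolding choice_function_def by blast+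
  \<comment> \<open>Every optimal gamble is realised by some normal form decision, which is then
    itself optimal and survives by \<open>sub\<close>.\<close>
  have opt_G: "opt1 (gamb T) A \<subseteq> ?G"
  proof
    fix X assume X: "X \<in> opt1 (gamb T) A"
    then obtain U where "U \<in> nfd T" "X = gamble U" using opt(2) by (auto simp: gamb_eq_image)
    with X sub show "X \<in> ?G" by (auto simp: norm_opt_iff gamb_set_eq_image)
  qed
  \<comment> \<open>Backward induction with \<open>opt2\<close> has discarded only gambles that are
    not optimal for \<open>opt1\<close>, so the optimal set is unchanged.\<close>
  have "opt1 ?G A = opt1 (gamb T) A"
    using assms(4)[unfolded insensitivity_to_omission_def, rule_format, of A "gamb T" ?G]
      A finite_gamb gamb_nonempty[OF assms(8)] cons finite_subset[OF G finite_gamb]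
      consistent_gambles_subset[OF cons G] opt(1) opt_G G by blast
  then show ?thesis
    using sub back_opt_subset_nfd[of opt2 A T]
    by (auto simp: norm_opt_iff norm_opt_set_def gamb_nf_def)
qed

end
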